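(* Let $G$ be a spider graph on $n$ vertices with $\ell \geq 3$ legs of lengths $k_1\geq k_2\geq \dots\geq k_{\ell}$. If $2 \leq s\leq \ell$, then $\operatorname{dmg}(G; s) =\left(\sum_{i=1}^s k_i\right) -1$, and if $s > \ell$, then $\operatorname{dmg}(G; s) =n-2$.
   Context: A spider graph with $\ell\ge 3$ legs of lengths $k_1,\dots,k_\ell\ge 1$ is the tree obtained from a center vertex $c$ and $\ell$ disjoint paths (the legs), the $i$-th having $k_i$ vertices (not counting $c$), by joining $c$ to one endpoint of each path; so $n=1+\sum_{i=1}^{\ell}k_i$. The game with one cop and $s$ robbers on a finite simple graph $G$ is a perfect-information game. In round $0$ the cop chooses an initial vertex, and then each robber chooses an initial vertex (several robbers may share a vertex). Each subsequent round consists of a turn for the cop followed by a turn for the robbers; on their turn, each player may stay put or move to a neighboring vertex (on the robbers' turn every uncaptured robber may do so). Whenever the cop occupies the same vertex as one or more robbers, all those robbers are captured and take no further part in the game. If a robber occupies a vertex $v$ at the end of some round (including round $0$) and that robber is not captured in the following round, then $v$ becomes damaged (and stays damaged). The robbers aim to maximize, and the cop aims to minimize, the total number of damaged vertices. The $s$-robber damage number $\operatorname{dmg}(G;s)$ is the number of vertices damaged under optimal play, i.e. the smallest $d$ such that the cop has a strategy guaranteeing that at most $d$ vertices are ever damaged, whatever the $s$ robbers do. *)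

theory Defs
  imports "Graph_Theory.Pair_Digraph"
begin

text \<open>
  Finite simple graphs are the \<^locale>\<open>pair_graph\<close>s, i.e. finite loop-free symmetric digraphs
  whose arcs are pairs of vertices; each undirected edge is represented by its two arcs.
\<close>

text \<open>
  A leg is the list of its vertices, starting at the neighbour of the center \<open>c\<close>. Thus
  \<open>zip (c # P) P\<close> lists the consecutive pairs of the path that leads from \<open>c\<close> through the leg
  \<open>P\<close>.
\<close>

definition leg_arcs :: "'a \<Rightarrow> 'a list \<Rightarrow> 'a rel" where
  "leg_arcs c P = set (zip (c # P) P)"

definition spider :: "'a pair_pre_digraph \<Rightarrow> nat list \<Rightarrow> bool" where
  "spider G ks \<longleftrightarrow>
     3 \<le> length ks \<and> (\<forall>k\<in>set ks. 1 \<le> k) \<and>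
     (\<exists>c legs. map length legs = ks \<and> distinct (c # concat legs) \<and>
        pverts G = set (c # concat legs) \<and>
        parcs G = (\<Union>P\<in>set legs. leg_arcs c P \<union> (leg_arcs c P)\<inverse>))"

definition legal_move :: "'a pair_pre_digraph \<Rightarrow> 'a \<Rightarrow> 'a \<Rightarrow> bool" where
  "legal_move G u v \<longleftrightarrow> v = u \<or> (u, v) \<in> parcs G"

text \<open>
  A play of the robbers is a sequence \<open>r\<close>, where \<open>r t ! i\<close> is the position of robber \<open>i\<close> at the end
  of round \<open>t\<close>. A cop strategy maps the robbers' positions in all the rounds completed so far to
  the next position of the cop (its initial vertex for the empty history); the cop's own earlier
  moves are determined by the strategy. Legality is imposed on all histories, also those that
  cannot occur, which does not restrict the cop: the values there can be chosen freely.
\<close>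

definition cop_strategy :: "'a pair_pre_digraph \<Rightarrow> ('a list list \<Rightarrow> 'a) \<Rightarrow> bool" where
  "cop_strategy G \<sigma> \<longleftrightarrow>
     \<sigma> [] \<in> pverts G \<and> (\<forall>h R. legal_move G (\<sigma> h) (\<sigma> (h @ [R])))"

definition cop_pos :: "('a list list \<Rightarrow> 'a) \<Rightarrow> (nat \<Rightarrow> 'a list) \<Rightarrow> nat \<Rightarrow> 'a" where
  "cop_pos \<sigma> r t = \<sigma> (map r [0..<t])"

text \<open>
  \<open>captured c r t i\<close>: robber \<open>i\<close> has been captured by the end of round \<open>t\<close>, where \<open>c t\<close> is the
  position of the cop in round \<open>t\<close>. In a round after round 0 this happens either on the cop's turn
  (the cop moves onto the robber) or on the robbers' turn (the robber moves onto the cop).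
\<close>

primrec captured :: "(nat \<Rightarrow> 'a) \<Rightarrow> (nat \<Rightarrow> 'a list) \<Rightarrow> nat \<Rightarrow> nat \<Rightarrow> bool" where
  "captured c r 0 i \<longleftrightarrow> r 0 ! i = c 0"
| "captured c r (Suc t) i \<longleftrightarrow>
     captured c r t i \<or> r t ! i = c (Suc t) \<or> r (Suc t) ! i = c (Suc t)"

text \<open>A captured robber is out of the game; by convention its recorded position stays fixed.\<close>

definition robber_play ::
  "'a pair_pre_digraph \<Rightarrow> nat \<Rightarrow> (nat \<Rightarrow> 'a) \<Rightarrow> (nat \<Rightarrow> 'a list) \<Rightarrow> bool" where
  "robber_play G s c r \<longleftrightarrow>
     (\<forall>t. length (r t) = s) \<and> (\<forall>i<s. r 0 ! i \<in> pverts G) \<and>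
     (\<forall>t. \<forall>i<s. if captured c r t i \<or> r t ! i = c (Suc t)
                then r (Suc t) ! i = r t ! i
                else legal_move G (r t ! i) (r (Suc t) ! i))"

text \<open>
  Since captured robbers remain captured, \<open>\<not> captured c r (Suc t) i\<close> says that robber \<open>i\<close> is still
  in the game at the end of round \<open>t\<close> and is not captured in the following round.
\<close>

definition damaged :: "nat \<Rightarrow> (nat \<Rightarrow> 'a) \<Rightarrow> (nat \<Rightarrow> 'a list) \<Rightarrow> 'a set" where
  "damaged s c r = {v. \<exists>t. \<exists>i<s. r t ! i = v \<and> \<not> captured c r (Suc t) i}"

definition cop_guarantees :: "'a pair_pre_digraph \<Rightarrow> nat \<Rightarrow> nat \<Rightarrow> bool" where
  "cop_guarantees G s d \<longleftrightarrow>
     (\<exists>\<sigma>. cop_strategy G \<sigma> \<and>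
        (\<forall>r. robber_play G s (cop_pos \<sigma> r) r \<longrightarrow> card (damaged s (cop_pos \<sigma> r) r) \<le> d))"

definition dmg :: "'a pair_pre_digraph \<Rightarrow> nat \<Rightarrow> nat" where
  "dmg G s = (LEAST d. cop_guarantees G s d)"

lemma leg_arcs_subset: "leg_arcs c P \<subseteq> set (c # P) \<times> set P"
  unfolding leg_arcs_def by (auto dest: set_zip_leftD set_zip_rightD)

lemma leg_arcs_irrefl:
  assumes "distinct (c # P)" "(u, v) \<in> leg_arcs c P"
  shows "u \<noteq> v"
proof -
  obtain j where "j < length P" "u = (c # P) ! j" "v = P ! j"
    using assms(2) by (auto simp: leg_arcs_def in_set_zip)
  then show ?thesis
    using nth_eq_iff_index_eq[OF assms(1), of j "Suc j"] by auto
qed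

lemma spider_pair_graph:
  assumes "spider G ks"
  shows "pair_graph G"
proof -
  obtain c legs where d: "distinct (c # concat legs)"
    and V: "pverts G = set (c # concat legs)"
    and A: "parcs G = (\<Union>P\<in>set legs. leg_arcs c P \<union> (leg_arcs c P)\<inverse>)"
    using assms unfolding spider_def by blast
  have "parcs G \<subseteq> pverts G \<times> pverts G"
    unfolding A V using leg_arcs_subset[of c] by fastforce
  moreover have "finite (parcs G)"
    by (auto simp: A leg_arcs_def)
  moreover have "u \<noteq> v" if uv: "(u, v) \<in> parcs G" for u v
  proof -
    obtain P where P: "P \<in> set legs" "(u, v) \<in> leg_arcs c P \<or> (v, u) \<in> leg_arcs c P"
      using uv A by auto
    have "distinct (c # P)"
      using d P(1) by (auto simp: distinct_concat_iff)
    then show ?thesis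
      using P(2) leg_arcs_irrefl by metis
  qed
  moreover have "sym (parcs G)"
    unfolding A by (auto simp: sym_def)
  ultimately show ?thesis
    using V by unfold_locales (auto simp: symmetric_def)
qed

lemma card_spider:
  assumes "spider G ks"
  shows "card (pverts G) = 1 + sum_list ks"
proof -
  obtain c legs where "map length legs = ks" "distinct (c # concat legs)"
    "pverts G = set (c # concat legs)"
    using assms unfolding spider_def by blast
  then show ?thesis
    by (auto simp: distinct_card length_concat simp del: set_concat)
qed

lemma damaged_subset:
  assumes "pair_graph G" "robber_play G s c r"
  shows "damaged s c r \<subseteq> pverts G"
proof -
  interpret pair_graph G by fact
  have step: "v \<in> pverts G" if "legal_move G u v" "u \<in> pverts G" for u v
    using that arc_snd_in_verts[of "(u, v)"] unfolding legal_move_def by auto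
  have "\<forall>i<s. r t ! i \<in> pverts G" for t
  proof (induction t)
    case 0
    then show ?case using assms(2) by (simp add: robber_play_def)
  next
    case (Suc t)
    then show ?case using assms(2) step unfolding robber_play_def by metis
  qed
  then show ?thesis by (auto simp: damaged_def)
qed

text \<open>On a nonempty finite simple graph, the minimum defining \<^const>\<open>dmg\<close> is over a nonempty set.\<close>

lemma cop_guarantees_card:
  assumes "pair_graph G" "pverts G \<noteq> {}"
  shows "cop_guarantees G s (card (pverts G))"
proof -
  interpret pair_graph G by fact
  obtain v where "v \<in> pverts G" using assms(2) by blast
  then have "cop_strategy G (\<lambda>_. v)"
    by (simp add: cop_strategy_def legal_move_def)
  then show ?thesis
    unfolding cop_guarantees_def
    using damaged_subset[OF assms(1)] card_mono[OF pair_finite_verts] by blast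
qed

end

theory Submission
  imports Defs
begin

text \<open>
  Upper bound: the cop alternates between the center and its neighbor \<open>v\<close> in an initially occupied
  leg, whatever the robbers do. Then neither the center nor \<open>v\<close> is ever damaged, so every robber
  stays in its own leg, and at most \<open>s\<close> legs lose vertices.

  Lower bound: each robber lives on an arm, a path leading away from the cop's initial vertex
  \<open>p\<close>, and sees the cop only through a 1-Lipschitz coordinate \<open>z\<close> along that arm. A robber that
  starts at depth 2 damages the rest of its arm, either by sweeping (out to the end and back to
  depth 1) or by shadowing (keeping distance 2 from the cop before finally running out), so only
  \<open>p\<close> and its neighbors are in question. If \<open>p\<close> is the center, the legs are swept one after the other
  by increasing length while the robbers in the others shadow. When the cop leaves \<open>p\<close> for
  a leg \<open>i\<close>, the shadows in all legs other than \<open>i\<close> move to depth 1, and only leg \<open>i\<close> and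
  the leg being swept can still have an undamaged neighbor of \<open>p\<close>. A duel between the sweeper and
  the shadow in the longer leg \<open>i\<close> settles one of these two. If \<open>p\<close> is not the center, then one such duel
  between the two sides of \<open>p\<close> suffices.
\<close>

section \<open>Robber routes in a one-dimensional coordinate\<close>

definition lipschitz_seq :: "(nat \<Rightarrow> int) \<Rightarrow> bool" where
  "lipschitz_seq z \<longleftrightarrow> (\<forall>t. \<bar>z (Suc t) - z t\<bar> \<le> 1)"

lemma lipschitz_seq_diff:
  assumes "lipschitz_seq z" "t \<le> u"
  shows "\<bar>z u - z t\<bar> \<le> int u - int t"
  using assms(2)
proof (induction u rule: dec_induct)
  case base
  then show ?case by simp
next
  case (step u)
  have "\<bar>z (Suc u) - z u\<bar> \<le> 1" using assms(1) by (simp add: lipschitz_seq_def)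
  with step show ?case by linarith
qed

text \<open>
  Positions on an arm of length \<open>k\<close> are the depths \<open>1..k\<close>, the cop's initial vertex having
  coordinate \<open>z 0 \<le> 0\<close>. The sweeper waits one extra round at depth \<open>k\<close>: if it turned back
  at once it could run into a cop in pursuit, and the end of the arm would not be damaged.
\<close>

primrec shadow :: "int \<Rightarrow> nat \<Rightarrow> (nat \<Rightarrow> int) \<Rightarrow> nat \<Rightarrow> int" where
  "shadow k M z 0 = max 1 (min k (z 0 + 2))"
| "shadow k M z (Suc t) =
     (if Suc t \<le> M then max 1 (min k (z (Suc t) + 2)) else min k (shadow k M z t + 1))"

definition sweep :: "int \<Rightarrow> nat \<Rightarrow> int" where
  "sweep k u = (if int u + 2 \<le> k then int u + 2 else max 1 (2 * k - 1 - int u))"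

text \<open>Makes a sweep conditional on the cop having waited at its initial vertex. For
  \<open>t < \<beta>\<close> the test looks into the future; natural subtraction keeps the sweep at
  its starting depth until then, so that the choice can stay open.\<close>

definition route :: "int \<Rightarrow> nat \<Rightarrow> nat \<Rightarrow> (nat \<Rightarrow> int) \<Rightarrow> nat \<Rightarrow> int" where
  "route k \<beta> M z t = (if \<forall>u\<le>\<beta>. z u = 0 then sweep k (t - \<beta>) else shadow k M z t)"

text \<open>The clauses exclude the two ways of being caught, the second one being the cop's own
  move. Together they exclude capture through round \<open>Suc t\<close>, which is what damage at
  \<open>x t\<close> requires.\<close>

definition escapes :: "(nat \<Rightarrow> 'b) \<Rightarrow> (nat \<Rightarrow> 'b) \<Rightarrow> nat \<Rightarrow> bool" where
  "escapes x z t \<longleftrightarrow> (\<forall>u\<le>Suc t. x u \<noteq> z u) \<and> (\<forall>u\<le>t. x u \<noteq> z (Suc u))"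

text \<open>The robbers act after the cop in every round, so a response in round \<open>t\<close>
  may use the cop's position of that same round.\<close>

definition causal :: "((nat \<Rightarrow> 'b) \<Rightarrow> nat \<Rightarrow> 'c) \<Rightarrow> bool" where
  "causal F \<longleftrightarrow> (\<forall>z z' t. (\<forall>u\<le>t. z u = z' u) \<longrightarrow> F z t = F z' t)"

definition walk_on :: "int \<Rightarrow> ((nat \<Rightarrow> int) \<Rightarrow> nat \<Rightarrow> int) \<Rightarrow> bool" where
  "walk_on k \<rho> \<longleftrightarrow> causal \<rho> \<and>
     (\<forall>z. lipschitz_seq z \<longrightarrow> lipschitz_seq (\<rho> z) \<and> (\<forall>t. 1 \<le> \<rho> z t \<and> \<rho> z t \<le> k))"

lemma shadow_cong:
  assumes "\<forall>u\<le>t. z u = z' u"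
  shows "shadow k M z t = shadow k M z' t"
  using assms by (induction t) auto

lemma shadow_early: "t \<le> M \<Longrightarrow> shadow k M z t = max 1 (min k (z t + 2))"
  by (cases t) auto

lemma shadow_bounds:
  assumes "1 \<le> k"
  shows "1 \<le> shadow k M z t \<and> shadow k M z t \<le> k"
  using assms by (induction t) auto

text \<open>The gap survives the switch to running after \<open>M\<close>, because the cop cannot
  gain on a robber moving outward at full speed.\<close>

lemma shadow_ahead:
  assumes "1 \<le> k" "lipschitz_seq z"
  shows "shadow k M z t = k \<or> z t + 2 \<le> shadow k M z t"
proof (induction t)
  case 0
  then show ?case using assms(1) by auto
next
  case (Suc t)
  have "\<bar>z (Suc t) - z t\<bar> \<le> 1" using assms(2) by (simp add: lipschitz_seq_def)
  with Suc show ?case using assms(1) by auto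
qed

lemma lipschitz_shadow:
  assumes "1 \<le> k" "lipschitz_seq z"
  shows "lipschitz_seq (shadow k M z)"
  unfolding lipschitz_seq_def
proof
  fix t
  have "\<bar>z (Suc t) - z t\<bar> \<le> 1" using assms(2) by (simp add: lipschitz_seq_def)
  then show "\<bar>shadow k M z (Suc t) - shadow k M z t\<bar> \<le> 1"
    using shadow_early[of t M k z] shadow_bounds[OF assms(1), of M z t]
    by (cases "Suc t \<le> M") (simp_all add: max_def min_def abs_if split: if_splits)
qed

lemma walk_on_shadow: "1 \<le> k \<Longrightarrow> walk_on k (shadow k M)"
  unfolding walk_on_def causal_def
  using shadow_cong lipschitz_shadow shadow_bounds by blast

lemma sweep_bounds: "1 \<le> k \<Longrightarrow> 1 \<le> sweep k u \<and> sweep k u \<le> k"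
  by (auto simp: sweep_def)

lemma lipschitz_sweep: "1 \<le> k \<Longrightarrow> lipschitz_seq (\<lambda>t. sweep k (t - \<beta>))"
  unfolding lipschitz_seq_def
proof
  fix t
  assume "1 \<le> k"
  then show "\<bar>sweep k (Suc t - \<beta>) - sweep k (t - \<beta>)\<bar> \<le> 1"
    by (cases "\<beta> \<le> t") (auto simp: sweep_def Suc_diff_le)
qed

lemma sweep_0: "1 \<le> k \<Longrightarrow> sweep k 0 = min 2 k"
  by (auto simp: sweep_def)

lemma walk_on_route:
  assumes "1 \<le> k" "\<beta> \<le> M"
  shows "walk_on k (route k \<beta> M)"
  unfolding walk_on_def
proof (intro conjI allI impI)
  \<comment> \<open>Before \<open>\<beta>\<close> the branches cannot be told apart: as long as the
    cop is at 0, the shadow stands at \<open>min 2 k\<close>, which is where the sweep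
    starts.\<close>
  have half: "route k \<beta> M z t = route k \<beta> M z' t"
    if "\<forall>u\<le>t. z u = z' u" "\<forall>u\<le>\<beta>. z u = 0" for z z' t
  proof (cases "\<beta> \<le> t")
    case True
    then show ?thesis using that by (auto simp: route_def)
  next
    case False
    then show ?thesis
      using that shadow_early[of t M k z'] assms
      by (auto simp: route_def sweep_0)
  qed
  show "causal (route k \<beta> M)"
    unfolding causal_def
  proof (intro allI impI)
    fix z z' :: "nat \<Rightarrow> int" and t
    assume eq: "\<forall>u\<le>t. z u = z' u"
    consider "\<forall>u\<le>\<beta>. z u = 0" | "\<forall>u\<le>\<beta>. z' u = 0" |
      "\<not> (\<forall>u\<le>\<beta>. z u = 0)" "\<not> (\<forall>u\<le>\<beta>. z' u = 0)" by blast
    then show "route k \<beta> M z t = route k \<beta> M z' t"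
    proof cases
      case 1
      then show ?thesis using half eq by blast
    next
      case 2
      then show ?thesis using half[of t z' z] eq by simp
    next
      case 3
      then show ?thesis unfolding route_def using shadow_cong[OF eq, of k M] by argo
    qed
  qed
next
  fix z :: "nat \<Rightarrow> int" and t
  assume "lipschitz_seq z"
  then show "lipschitz_seq (route k \<beta> M z)"
    unfolding route_def
    using lipschitz_sweep[OF assms(1)] lipschitz_shadow[OF assms(1)]
    by (auto simp: lipschitz_seq_def)
  show "1 \<le> route k \<beta> M z t" "route k \<beta> M z t \<le> k"
    using sweep_bounds[OF assms(1)] shadow_bounds[OF assms(1)] by (auto simp: route_def)
qed

text \<open>The first visit to depth \<open>d\<close> works: until then the robber is short of the
  end, so \<open>shadow_ahead\<close> keeps the cop at least 2 behind. The run after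
  \<open>M\<close> ensures that the visit happens.\<close>

lemma shadow_covers:
  assumes k: "1 \<le> k" and z: "lipschitz_seq z" "z 0 \<le> 0" and d: "2 \<le> d" "d \<le> k"
  shows "\<exists>t. shadow k M z t = d \<and> escapes (shadow k M z) z t"
proof -
  let ?x = "shadow k M z"
  have run: "min k (int n) \<le> ?x (M + n)" for n
  proof (induction n)
    case 0
    then show ?case using shadow_bounds[OF k, of M z M] by simp
  next
    case (Suc n)
    then show ?case by auto
  qed
  have ex: "d \<le> ?x (M + nat k)" using run[of "nat k"] d k by simp
  define t where "t = (LEAST t. d \<le> ?x t)"
  have t1: "d \<le> ?x t" unfolding t_def by (rule LeastI[where P="\<lambda>t. d \<le> ?x t", OF ex])
  have less: "?x u < d" if "u < t" for u
    using not_less_Least[of u "\<lambda>t. d \<le> ?x t"] that unfolding t_def by force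
  have lz: "\<bar>z (Suc u) - z u\<bar> \<le> 1" for u using z(1) by (simp add: lipschitz_seq_def)
  have ahead: "?x u = k \<or> z u + 2 \<le> ?x u" for u by (rule shadow_ahead[OF k z(1)])
  \<comment> \<open>For \<open>d = k\<close> the gap at time \<open>t\<close> itself is inherited
    from the previous round, when the robber was still below \<open>k\<close>, or from the
    start.\<close>
  have t2: "?x t = d \<and> z t \<le> d - 2"
  proof (cases t)
    case 0
    then show ?thesis using t1 z(2) d by auto
  next
    case (Suc u)
    have "?x u < d" using less Suc by simp
    moreover have "\<bar>?x (Suc u) - ?x u\<bar> \<le> 1"
      using lipschitz_shadow[OF k z(1)] by (simp add: lipschitz_seq_def)
    ultimately show ?thesis using t1 Suc ahead[of u] lz[of u] d by (auto simp del: shadow.simps)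
  qed
  have below: "z u \<le> ?x u - 2" if "u \<le> t" for u
    using that ahead[of u] less[of u] t2 d by (cases "u = t") auto
  have "?x u \<noteq> z u" if "u \<le> Suc t" for u
  proof (cases "u = Suc t")
    case True
    then show ?thesis using t2 ahead[of "Suc t"] lz[of t] d by (auto simp del: shadow.simps)
  next
    case False
    then show ?thesis using below[of u] that by auto
  qed
  moreover have "?x u \<noteq> z (Suc u)" if "u \<le> t" for u
    using below[OF that] lz[of u] by linarith
  ultimately show ?thesis using t2 unfolding escapes_def by blast
qed

text \<open>A cop at coordinate -1 or below draws the shadow down to depth 1, and one that never
  reached depth \<open>k\<close> has not cornered it at the end of the arm before.\<close>

lemma shadow_first:
  assumes k: "1 \<le> k" and z: "lipschitz_seq z" and t: "t \<le> M" "z t \<le> -1" "\<forall>u\<le>t. z u < k"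
  shows "shadow k M z t = 1 \<and> escapes (shadow k M z) z t"
proof -
  let ?x = "shadow k M z"
  have lz: "\<bar>z (Suc u) - z u\<bar> \<le> 1" for u using z by (simp add: lipschitz_seq_def)
  have ahead: "?x u = k \<or> z u + 2 \<le> ?x u" for u by (rule shadow_ahead[OF k z])
  have x: "?x t = 1" using shadow_early[OF t(1), of k z] t(2) k by auto
  have "?x u \<noteq> z u" if "u \<le> Suc t" for u
  proof (cases "u = Suc t")
    case True
    then show ?thesis using lz[of t] t(2) shadow_bounds[OF k, of M z u] by auto
  next
    case False
    then have "z u < k" using t(3) that by simp
    then show ?thesis using ahead[of u] by linarith
  qed
  moreover have "?x u \<noteq> z (Suc u)" if "u \<le> t" for u
  proof (cases "u = t")
    case True
    then show ?thesis using lz[of t] t(2) x by auto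
  next
    case False
    then have "z (Suc u) < k" using t(3) that by auto
    then show ?thesis using ahead[of u] lz[of u] by auto
  qed
  ultimately show ?thesis using x unfolding escapes_def by blast
qed

text \<open>On its way out the sweeper has a lead of 2 at time \<open>\<beta>\<close> and moves at
  full speed.\<close>

lemma sweep_covers:
  assumes z: "lipschitz_seq z" "\<forall>u\<le>\<beta>. z u = 0" and d: "2 \<le> d" "d \<le> k"
  shows "\<exists>t. sweep k (t - \<beta>) = d \<and> escapes (\<lambda>t. sweep k (t - \<beta>)) z t"
proof -
  define t where "t = \<beta> + nat (d - 2)"
  have zb: "z u \<le> int (u - \<beta>)" for u
  proof (cases "u \<le> \<beta>")
    case True
    then show ?thesis using z(2) by simp
  next
    case False
    then show ?thesis using lipschitz_seq_diff[OF z(1), of \<beta> u] z(2) by auto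
  qed
  have zs: "z (Suc u) \<le> int (u - \<beta>) + 1" for u
    using zb[of u] z(1) unfolding lipschitz_seq_def by (smt (verit))
  have w: "sweep k (u - \<beta>) = int (u - \<beta>) + 2" if "u \<le> t" for u
    using that d by (auto simp: sweep_def t_def)
  have "sweep k (u - \<beta>) \<noteq> z u" if "u \<le> Suc t" for u
  proof (cases "u = Suc t")
    case True
    \<comment> \<open>For \<open>d = k\<close> the extra waiting round counts: in round
      \<open>Suc t\<close> the cop may be at \<open>k - 1\<close>, so the robber must not have
      turned back yet.\<close>
    have "Suc t - \<beta> = Suc (nat (d - 2))" by (simp add: t_def)
    then show ?thesis using True d zb[of u] by (auto simp: sweep_def)
  next
    case False
    then show ?thesis using w[of u] zb[of u] that by auto
  qed
  moreover have "sweep k (u - \<beta>) \<noteq> z (Suc u)" if "u \<le> t" for u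
    using w[OF that] zs[of u] by linarith
  moreover have "sweep k (t - \<beta>) = d" using w[of t] d by (simp add: t_def)
  ultimately show ?thesis unfolding escapes_def by blast
qed

text \<open>The sweeper is back at depth 1 after \<open>2 * k - 2\<close> rounds and has to survive
  one more for the damage; a cop at coordinates at most 0 meets it nowhere.\<close>

lemma sweep_first:
  assumes k: "1 \<le> k" and z: "\<forall>u<\<beta> + nat (2 * k). z u \<le> 0"
  shows "\<exists>t. sweep k (t - \<beta>) = 1 \<and> escapes (\<lambda>t. sweep k (t - \<beta>)) z t"
proof -
  define t where "t = \<beta> + nat (2 * k - 2)"
  have "Suc t < \<beta> + nat (2 * k)" using k by (simp add: t_def)
  then have "z u < sweep k v" if "u \<le> Suc t" for u v
  proof -
    have "z u \<le> 0" using z that \<open>Suc t < \<beta> + nat (2 * k)\<close> by simp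
    then show ?thesis using sweep_bounds[OF k, of v] by linarith
  qed
  then have "escapes (\<lambda>t. sweep k (t - \<beta>)) z t"
    unfolding escapes_def by (simp add: less_imp_neq[symmetric])
  moreover have "sweep k (t - \<beta>) = 1" using k by (auto simp: sweep_def t_def)
  ultimately show ?thesis by blast
qed

text \<open>
  If the evader at distance 1 on the shorter arm is ever threatened, then the pursuer leaves the
  longer arm, whose shadow then reaches distance 1 as well; capturing that shadow first would cost
  the pursuer a trip to the end of the longer arm and back.
\<close>

lemma sweep_or_shadow_first:
  assumes k: "1 \<le> k" "k \<le> k'" and z: "lipschitz_seq z'"
    and hold: "\<forall>u\<le>\<beta>. z' u \<le> 0"
    and opp: "\<And>u. 1 \<le> z u \<Longrightarrow> z' u \<le> -1" and M: "\<beta> + nat (2 * k) \<le> M"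
  shows "(\<exists>t. sweep k (t - \<beta>) = 1 \<and> escapes (\<lambda>t. sweep k (t - \<beta>)) z t) \<or>
    (\<exists>t. shadow k' M z' t = 1 \<and> escapes (shadow k' M z') z' t)"
proof (cases "\<forall>u<\<beta> + nat (2 * k). z u \<le> 0")
  case True
  then show ?thesis using sweep_first[OF k(1)] by blast
next
  case False
  then obtain t where t: "t < \<beta> + nat (2 * k)" "1 \<le> z t" by force
  \<comment> \<open>From at most 0 at time \<open>\<beta>\<close> to depth \<open>k'\<close> and
    back to -1 takes at least \<open>2 * k' + 1\<close> rounds, more than the fewer than
    \<open>2 * k\<close> available.\<close>
  have "z' u < k'" if "u \<le> t" for u
  proof (rule ccontr)
    assume "\<not> z' u < k'"
    moreover from this have "\<beta> \<le> u" using hold[rule_format, of u] k by linarith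
    moreover have "\<bar>z' u - z' \<beta>\<bar> \<le> int u - int \<beta>" "\<bar>z' t - z' u\<bar> \<le> int t - int u"
      using lipschitz_seq_diff[OF z] \<open>\<beta> \<le> u\<close> \<open>u \<le> t\<close> by auto
    moreover have "z' \<beta> \<le> 0" "z' t \<le> -1" using hold opp[OF t(2)] by auto
    ultimately show False using t(1) k by linarith
  qed
  then show ?thesis
    using shadow_first[of k' z' t M] opp[OF t(2)] z k t M by auto
qed

section \<open>Playing causal responses against a cop strategy\<close>

text \<open>Strategy and responses determine each other, so the trajectory is built by recursion on
  rounds. \<open>R\<close> receives the part known so far, padded with \<open>undefined\<close>; a
  causal \<open>R\<close> does not look at the padding in the rounds before
  \<open>t\<close>.\<close>

fun cop_run :: "('a list list \<Rightarrow> 'a) \<Rightarrow> ((nat \<Rightarrow> 'a) \<Rightarrow> nat \<Rightarrow> 'a list) \<Rightarrow> nat \<Rightarrow> 'a" where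
  "cop_run \<sigma> R t = \<sigma> (map (R (\<lambda>u. if u < t then cop_run \<sigma> R u else undefined)) [0..<t])"

declare cop_run.simps [simp del]

lemma cop_run_eq:
  assumes "causal R"
  shows "cop_run \<sigma> R t = \<sigma> (map (R (cop_run \<sigma> R)) [0..<t])"
proof -
  have "R (\<lambda>u. if u < t then cop_run \<sigma> R u else undefined) v = R (cop_run \<sigma> R) v" if "v < t" for v
    by (rule assms[unfolded causal_def, rule_format]) (use that in simp)
  then have "map (R (\<lambda>u. if u < t then cop_run \<sigma> R u else undefined)) [0..<t] =
      map (R (cop_run \<sigma> R)) [0..<t]" by simp
  then show ?thesis using cop_run.simps[of \<sigma> R t] by argo
qed

lemma route_eq_sweep: "\<forall>u\<le>\<beta>. z u = 0 \<Longrightarrow> route k \<beta> M z = (\<lambda>t. sweep k (t - \<beta>))"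
  by (auto simp: route_def)

lemma route_eq_shadow: "\<not> (\<forall>u\<le>\<beta>. z u = 0) \<Longrightarrow> route k \<beta> M z = shadow k M z"
  by (auto simp: route_def fun_eq_iff)

lemma route_covers:
  assumes "1 \<le> k" "lipschitz_seq z" "z 0 \<le> 0" "2 \<le> d" "d \<le> k"
  shows "\<exists>t. route k \<beta> M z t = d \<and> escapes (route k \<beta> M z) z t"
proof (cases "\<forall>u\<le>\<beta>. z u = 0")
  case True
  then show ?thesis using sweep_covers[OF assms(2) True assms(4,5)] by (simp add: route_eq_sweep)
next
  case False
  then show ?thesis using shadow_covers[OF assms] by (simp add: route_eq_shadow)
qed

text \<open>
  The intended position of a robber is frozen at its first encounter with the cop; the second
  component records whether the encounter has happened.
\<close>

primrec freeze :: "(nat \<Rightarrow> 'a) \<Rightarrow> (nat \<Rightarrow> 'a) \<Rightarrow> nat \<Rightarrow> 'a \<times> bool" where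
  "freeze c x 0 = (x 0, x 0 = c 0)"
| "freeze c x (Suc t) =
     (let (p, b) = freeze c x t
      in if b \<or> p = c (Suc t) then (p, True) else (x (Suc t), x (Suc t) = c (Suc t)))"

lemma freeze_cong:
  assumes "\<forall>u\<le>t. c u = c' u" "\<forall>u\<le>t. x u = x' u"
  shows "freeze c x t = freeze c' x' t"
  using assms by (induction t) (auto split: prod.splits)

lemma captured_freeze:
  assumes "\<And>t. r t ! i = fst (freeze c x t)"
  shows "captured c r t i \<longleftrightarrow> snd (freeze c x t)"
proof (induction t)
  case 0
  then show ?case by (simp add: assms)
next
  case (Suc t)
  then show ?case by (auto simp: assms Let_def split: prod.splits)
qed

lemma freeze_free:
  assumes "\<forall>u\<le>t. x u \<noteq> c u" "\<forall>u<t. x u \<noteq> c (Suc u)"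
  shows "freeze c x t = (x t, False)"
  using assms by (induction t) auto

text \<open>The plans \<open>X i\<close> are functions of the cop's trajectory alone and ignore
  captures. Freezing turns them into a legal play in which each robber follows its plan until it
  first meets the cop, so the plans can be analysed separately against one common
  trajectory.\<close>

lemma robbers_can_follow:
  fixes G :: "'a pair_pre_digraph" and X :: "nat \<Rightarrow> (nat \<Rightarrow> 'a) \<Rightarrow> nat \<Rightarrow> 'a"
  assumes \<sigma>: "cop_strategy G \<sigma>"
    and X: "\<And>i. i < s \<Longrightarrow> causal (X i)"
    and legal: "\<And>i c. i < s \<Longrightarrow> c 0 = \<sigma> [] \<Longrightarrow> \<forall>t. legal_move G (c t) (c (Suc t)) \<Longrightarrow>
      X i c 0 \<in> pverts G \<and> (\<forall>t. legal_move G (X i c t) (X i c (Suc t)))"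
  obtains r c where "c 0 = \<sigma> []" "\<forall>t. legal_move G (c t) (c (Suc t))" "c = cop_pos \<sigma> r"
    "robber_play G s c r"
    "\<And>i t. i < s \<Longrightarrow> escapes (X i c) c t \<Longrightarrow> X i c t \<in> damaged s c r"
proof -
  define R where "R = (\<lambda>c t. map (\<lambda>i. fst (freeze c (X i c) t)) [0..<s])"
  have "causal R"
    unfolding causal_def R_def
  proof (intro allI impI map_cong refl)
    fix c c' :: "nat \<Rightarrow> 'a" and t i
    assume eq: "\<forall>u\<le>t. c u = c' u" and i: "i \<in> set [0..<s]"
    have "\<forall>u\<le>t. X i c u = X i c' u"
      using X[of i] eq i unfolding causal_def by auto
    then show "fst (freeze c (X i c) t) = fst (freeze c' (X i c') t)"
      using freeze_cong[OF eq] by metis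
  qed
  define c where "c = cop_run \<sigma> R"
  define r where "r = R c"
  have c: "c t = \<sigma> (map r [0..<t])" for t
    unfolding r_def c_def using cop_run_eq[OF \<open>causal R\<close>] by metis
  have c0: "c 0 = \<sigma> []" by (simp add: c)
  have step: "\<forall>t. legal_move G (c t) (c (Suc t))"
    using \<sigma> by (simp add: c cop_strategy_def)
  have r: "r t ! i = fst (freeze c (X i c) t)" if "i < s" for t i
    using that by (simp add: r_def R_def)
  have capt: "captured c r t i \<longleftrightarrow> snd (freeze c (X i c) t)" if "i < s" for t i
    using captured_freeze[of r i c "X i c"] r[OF that] by blast
  \<comment> \<open>A robber that is not frozen stands where its plan says, so its next move is
    legal because the plan's is.\<close>
  have last: "\<not> snd (freeze c (X i c) t) \<Longrightarrow> fst (freeze c (X i c) t) = X i c t" for t i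
    by (cases t) (auto simp: Let_def split: prod.splits if_splits)
  have "robber_play G s c r"
    unfolding robber_play_def
  proof (intro conjI allI impI)
    show "length (r t) = s" for t by (simp add: r_def R_def)
    show "r 0 ! i \<in> pverts G" if "i < s" for i
      using legal[OF that c0 step] r[OF that] by simp
    show "if captured c r t i \<or> r t ! i = c (Suc t) then r (Suc t) ! i = r t ! i
       else legal_move G (r t ! i) (r (Suc t) ! i)" if "i < s" for t i
      using legal[OF that c0 step] last[of i t] unfolding capt[OF that] r[OF that]
      by (auto simp: Let_def split: prod.splits)
  qed
  moreover have "X i c t \<in> damaged s c r" if i: "i < s" and esc: "escapes (X i c) c t" for i t
  proof -
    have "freeze c (X i c) (Suc t) = (X i c (Suc t), False)" "freeze c (X i c) t = (X i c t, False)"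
      using esc by (auto intro!: freeze_free simp: escapes_def simp del: freeze.simps)
    then have "r t ! i = X i c t" "\<not> captured c r (Suc t) i"
      using r[OF i, of t] capt[OF i, of "Suc t"] by simp_all
    then show ?thesis using i unfolding damaged_def by blast
  qed
  moreover have "c = cop_pos \<sigma> r" using c by (auto simp: cop_pos_def)
  ultimately show ?thesis using that[of c r, OF c0 step] by blast
qed

section \<open>Arms in the graph\<close>

text \<open>\<open>z\<close> is a coordinate on the whole graph, so it also tracks a cop that
  wanders off the arm. A robber on the arm whose depth differs from the cop's coordinate is not on
  the cop's vertex.\<close>

definition arm :: "'a pair_pre_digraph \<Rightarrow> int \<Rightarrow> (int \<Rightarrow> 'a) \<Rightarrow> ('a \<Rightarrow> int) \<Rightarrow> bool" where
  "arm G k f z \<longleftrightarrow> 1 \<le> k \<and>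
     (\<forall>d. 1 \<le> d \<and> d \<le> k \<longrightarrow> f d \<in> pverts G \<and> z (f d) = d) \<and>
     (\<forall>d. 1 \<le> d \<and> d < k \<longrightarrow> legal_move G (f d) (f (d + 1)) \<and> legal_move G (f (d + 1)) (f d)) \<and>
     (\<forall>u v. legal_move G u v \<longrightarrow> \<bar>z v - z u\<bar> \<le> 1)"

lemma arm_lipschitz:
  assumes "arm G k f z" "\<forall>t. legal_move G (c t) (c (Suc t))"
  shows "lipschitz_seq (\<lambda>t. z (c t))"
  using assms unfolding arm_def lipschitz_seq_def by blast

lemma arm_step:
  assumes "arm G k f z" "1 \<le> d" "d \<le> k" "1 \<le> d'" "d' \<le> k" "\<bar>d' - d\<bar> \<le> 1"
  shows "legal_move G (f d) (f d')"
proof -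
  consider "d' = d" | "d' = d + 1" | "d = d' + 1" using assms(6) by linarith
  then show ?thesis using assms by cases (auto simp: arm_def legal_move_def)
qed

lemma robbers_on_arms:
  assumes \<sigma>: "cop_strategy G \<sigma>"
    and arm: "\<And>i. i < s \<Longrightarrow> arm G (k i) (f i) (z i)"
    and \<rho>: "\<And>i. i < s \<Longrightarrow> walk_on (k i) (\<rho> i)"
  shows "\<exists>r c. c 0 = \<sigma> [] \<and> (\<forall>t. legal_move G (c t) (c (Suc t))) \<and> c = cop_pos \<sigma> r \<and>
    robber_play G s c r \<and>
    (\<forall>i<s. \<forall>t. escapes (\<rho> i (\<lambda>t. z i (c t))) (\<lambda>t. z i (c t)) t \<longrightarrow>
      f i (\<rho> i (\<lambda>t. z i (c t)) t) \<in> damaged s c r)"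
proof -
  define X where "X = (\<lambda>i c t. f i (\<rho> i (\<lambda>t. z i (c t)) t))"
  have X: "causal (X i)" if "i < s" for i
    using \<rho>[OF that] unfolding walk_on_def causal_def X_def by metis
  have bounds: "lipschitz_seq (\<rho> i (\<lambda>t. z i (c t))) \<and>
      (\<forall>t. 1 \<le> \<rho> i (\<lambda>t. z i (c t)) t \<and> \<rho> i (\<lambda>t. z i (c t)) t \<le> k i)"
    if "i < s" "\<forall>t. legal_move G (c t) (c (Suc t))" for i c
    using \<rho>[OF that(1)] arm_lipschitz[OF arm[OF that(1)] that(2)] unfolding walk_on_def by blast
  have legal: "X i c 0 \<in> pverts G \<and> (\<forall>t. legal_move G (X i c t) (X i c (Suc t)))"
    if "i < s" "c 0 = \<sigma> []" "\<forall>t. legal_move G (c t) (c (Suc t))" for i c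
  proof (intro conjI allI)
    note b = bounds[OF that(1,3)]
    show "X i c 0 \<in> pverts G"
      using b arm[OF that(1)] unfolding X_def arm_def by blast
    show "legal_move G (X i c t) (X i c (Suc t))" for t
      unfolding X_def using b by (intro arm_step[OF arm[OF that(1)]]) (auto simp: lipschitz_seq_def)
  qed
  show ?thesis
  proof (rule robbers_can_follow[OF \<sigma>, of s X])
    fix r c
    assume c: "c 0 = \<sigma> []" "\<forall>t. legal_move G (c t) (c (Suc t))"
      and r: "c = cop_pos \<sigma> r" "robber_play G s c r"
      and dam: "\<And>i t. i < s \<Longrightarrow> escapes (X i c) c t \<Longrightarrow> X i c t \<in> damaged s c r"
    have "f i (\<rho> i (\<lambda>t. z i (c t)) t) \<in> damaged s c r"
      if i: "i < s" and esc: "escapes (\<rho> i (\<lambda>t. z i (c t))) (\<lambda>t. z i (c t)) t" for i t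
    proof -
      \<comment> \<open>Hence a meeting on a vertex would be a meeting of coordinates.\<close>
      have "z i (X i c t) = \<rho> i (\<lambda>t. z i (c t)) t" for t
        using bounds[OF i c(2)] arm[OF i] unfolding X_def arm_def by blast
      then have "escapes (X i c) c t" using esc unfolding escapes_def by metis
      then show ?thesis using dam[OF i] unfolding X_def by blast
    qed
    then show ?thesis using c r by blast
  qed (fact X legal)+
qed

section \<open>Coordinates and arms of a spider\<close>

locale spider_legs =
  fixes G :: "'a pair_pre_digraph" and c :: 'a and legs :: "'a list list"
  assumes distinct_verts: "distinct (c # concat legs)"
    and verts: "pverts G = set (c # concat legs)"
    and arcs: "parcs G = (\<Union>P\<in>set legs. leg_arcs c P \<union> (leg_arcs c P)\<inverse>)"
    and leg_nonempty: "[] \<notin> set legs"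
    and some_leg: "legs \<noteq> []"
begin

definition len :: "nat \<Rightarrow> nat" where
  "len i = length (legs ! i)"

definition pos :: "nat \<Rightarrow> nat \<Rightarrow> 'a" where
  "pos i d = (c # legs ! i) ! d"

text \<open>The center is \<open>pos i 0\<close> for every leg \<open>i\<close>, so a vertex need
  not determine its leg; the minimum avoids choosing one.\<close>

definition depth :: "'a \<Rightarrow> nat" where
  "depth v = (LEAST d. \<exists>i<length legs. d \<le> len i \<and> v = pos i d)"

text \<open>Folds the spider onto a line: leg \<open>i\<close> on the positive side, all other legs
  together on the negative side.\<close>

definition coord :: "nat \<Rightarrow> 'a \<Rightarrow> int" where
  "coord i v = (if v \<in> set (legs ! i) then int (depth v) else - int (depth v))"

lemma len_pos: "i < length legs \<Longrightarrow> 1 \<le> len i"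
  using leg_nonempty nth_mem[of i legs] by (cases "legs ! i") (auto simp: len_def)

lemma pos_0 [simp]: "pos i 0 = c"
  by (simp add: pos_def)

lemma c_notin_leg: "i < length legs \<Longrightarrow> c \<notin> set (legs ! i)"
  using distinct_verts by auto

lemma set_leg: "set (legs ! i) = pos i ` {1..len i}"
proof -
  have "set (legs ! i) = (\<lambda>d. legs ! i ! d) ` {0..<len i}"
    by (auto simp: len_def in_set_conv_nth)
  also have "\<dots> = (\<lambda>d. pos i (Suc d)) ` {0..<len i}"
    by (simp add: pos_def)
  also have "\<dots> = pos i ` Suc ` {0..<len i}"
    by (simp only: image_image)
  finally show ?thesis by (simp add: image_Suc_atLeastLessThan atLeastLessThanSuc_atLeastAtMost)
qed

lemma legs_disjoint:
  assumes "i < length legs" "j < length legs" "i \<noteq> j"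
  shows "set (legs ! i) \<inter> set (legs ! j) = {}"
proof -
  have "distinct legs"
    using distinct_verts leg_nonempty by (simp add: distinct_concat_iff)
  then have "legs ! i \<noteq> legs ! j" using assms by (simp add: nth_eq_iff_index_eq)
  then show ?thesis using distinct_verts assms by (simp add: distinct_concat_iff)
qed

lemma inj_pos: "i < length legs \<Longrightarrow> inj_on (pos i) {0..len i}"
proof (rule inj_onI)
  fix d d'
  assume i: "i < length legs" and d: "d \<in> {0..len i}" "d' \<in> {0..len i}" "pos i d = pos i d'"
  have "distinct (c # legs ! i)"
    using distinct_verts i by (simp add: distinct_concat_iff)
  then show "d = d'"
    using d nth_eq_iff_index_eq[of "c # legs ! i" d d'] by (simp add: pos_def len_def)
qed

lemma pos_eq:
  assumes "i < length legs" "j < length legs" "d \<le> len i" "d' \<le> len j" "pos i d = pos j d'"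
  shows "d = d' \<and> (d = 0 \<or> i = j)"
proof (cases "i = j")
  case True
  then show ?thesis using inj_pos[OF assms(1)] assms by (auto dest: inj_onD)
next
  case False
  have leg: "pos m e \<in> set (legs ! m)" if "1 \<le> e" "e \<le> len m" for m e
    using that by (auto simp: set_leg)
  have "d = 0 \<or> d' = 0"
    using legs_disjoint[OF assms(1,2) False] leg[of d i] leg[of d' j] assms by auto
  moreover have "pos m e \<noteq> c" if "1 \<le> e" "e \<le> len m" "m < length legs" for m e
    using leg[OF that(1,2)] c_notin_leg[OF that(3)] by auto
  ultimately show ?thesis using assms by (metis One_nat_def Suc_leI neq0_conv pos_0)
qed

lemma depth_pos: "i < length legs \<Longrightarrow> d \<le> len i \<Longrightarrow> depth (pos i d) = d"
  unfolding depth_def by (rule Least_equality) (use pos_eq in blast)+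

lemma coord_pos:
  assumes "i < length legs" "m < length legs" "d \<le> len m"
  shows "coord i (pos m d) = (if m = i then int d else - int d)"
proof (cases "d = 0")
  case True
  then show ?thesis using depth_pos[OF assms(2,3)] by (simp add: coord_def)
next
  case False
  then have "pos m d \<in> set (legs ! m)" using assms by (auto simp: set_leg)
  then have "pos m d \<in> set (legs ! i) \<longleftrightarrow> m = i"
    using legs_disjoint[OF assms(1,2)] by auto
  then show ?thesis using depth_pos[OF assms(2,3)] by (cases "m = i") (simp_all add: coord_def)
qed

lemma set_legs: "set legs = (\<lambda>i. legs ! i) ` {..<length legs}"
  by (auto simp: set_conv_nth)

lemma verts_pos: "pverts G = {pos i d |i d. i < length legs \<and> d \<le> len i}"
proof -
  have leg: "insert c (set (legs ! i)) = pos i ` {0..len i}" for i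
  proof -
    have "{0..len i} = insert 0 {1..len i}" by auto
    then show ?thesis by (simp add: set_leg)
  qed
  have "pverts G = insert c (\<Union>i<length legs. set (legs ! i))"
    unfolding verts using set_legs by simp
  also have "\<dots> = (\<Union>i<length legs. insert c (set (legs ! i)))"
    using some_leg by auto
  also have "\<dots> = {pos i d |i d. i < length legs \<and> d \<le> len i}"
    unfolding leg by fastforce
  finally show ?thesis .
qed

lemma pos_in_verts: "i < length legs \<Longrightarrow> d \<le> len i \<Longrightarrow> pos i d \<in> pverts G"
  unfolding verts_pos by blast

lemma coord_eq_0: "v \<in> pverts G \<Longrightarrow> i < length legs \<Longrightarrow> coord i v = 0 \<longleftrightarrow> v = c"
proof -
  assume v: "v \<in> pverts G" and i: "i < length legs"
  then obtain m d where m: "m < length legs" "d \<le> len m" "v = pos m d" by (auto simp: verts_pos)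
  then have "v = c \<longleftrightarrow> d = 0" using pos_eq[OF m(1) i m(2), of 0] by auto
  then show ?thesis using coord_pos[OF i m(1,2)] m(3) by simp
qed

lemma leg_arcs_pos: "leg_arcs c (legs ! i) = {(pos i d, pos i (Suc d)) |d. d < len i}"
  unfolding leg_arcs_def set_zip by (simp add: pos_def len_def)

lemma legal_move_iff:
  "legal_move G u v \<longleftrightarrow> v = u \<or> (\<exists>i<length legs. \<exists>d<len i.
     u = pos i d \<and> v = pos i (Suc d) \<or> v = pos i d \<and> u = pos i (Suc d))"
proof -
  have "parcs G = (\<Union>i<length legs. leg_arcs c (legs ! i) \<union> (leg_arcs c (legs ! i))\<inverse>)"
    unfolding arcs set_legs by simp
  then show ?thesis
    unfolding legal_move_def leg_arcs_pos by auto
qed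

lemma coord_step:
  assumes "i < length legs" "legal_move G u v"
  shows "\<bar>coord i v - coord i u\<bar> \<le> 1"
  using assms by (auto simp: legal_move_iff coord_pos)

lemma legal_outward: "i < length legs \<Longrightarrow> d < len i \<Longrightarrow> legal_move G (pos i d) (pos i (Suc d))"
  and legal_inward: "i < length legs \<Longrightarrow> d < len i \<Longrightarrow> legal_move G (pos i (Suc d)) (pos i d)"
  by (auto simp: legal_move_iff)

lemma outer_arm:
  assumes "i < length legs" "e < len i"
  shows "arm G (int (len i) - int e) (\<lambda>d. pos i (nat (int e + d))) (\<lambda>v. coord i v - int e)"
  unfolding arm_def
proof (intro conjI allI impI)
  fix d :: int
  assume d: "1 \<le> d \<and> d < int (len i) - int e"
  then have "nat (int e + (d + 1)) = Suc (nat (int e + d))" "nat (int e + d) < len i" by auto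
  then show "legal_move G (pos i (nat (int e + d))) (pos i (nat (int e + (d + 1))))"
    "legal_move G (pos i (nat (int e + (d + 1)))) (pos i (nat (int e + d)))"
    using legal_outward[OF assms(1)] legal_inward[OF assms(1)] by simp_all
qed (use assms coord_step[OF assms(1)] in \<open>auto simp: coord_pos intro!: pos_in_verts\<close>)

lemma leg_arm:
  assumes "i < length legs"
  shows "arm G (int (len i)) (\<lambda>d. pos i (nat d)) (coord i)"
  using outer_arm[of i 0] len_pos[of i] assms by simp

definition inner :: "nat \<Rightarrow> nat \<Rightarrow> nat \<Rightarrow> int \<Rightarrow> 'a" where
  "inner i e j d = (if d \<le> int e then pos i (nat (int e - d)) else pos j (nat (d - int e)))"

text \<open>The coordinate is measured from a cop starting at depth \<open>e\<close> of leg
  \<open>i\<close>. It folds third legs onto leg \<open>j\<close>; a cop there seems to stand in the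
  robber's way, so escaping it in the coordinate is only harder than in the graph.\<close>

lemma inner_arm:
  assumes "i < length legs" "e \<le> len i" "j < length legs" "i \<noteq> j"
  shows "arm G (int e + int (len j)) (inner i e j) (\<lambda>v. int e - coord i v)"
  unfolding arm_def
proof (intro conjI allI impI)
  show "1 \<le> int e + int (len j)" using len_pos[OF assms(3)] by simp
next
  fix d :: int
  assume "1 \<le> d \<and> d \<le> int e + int (len j)"
  then show "inner i e j d \<in> pverts G" "int e - coord i (inner i e j d) = d"
    using assms by (auto simp: inner_def coord_pos intro!: pos_in_verts)
next
  fix d :: int
  assume d: "1 \<le> d \<and> d < int e + int (len j)"
  have "legal_move G (inner i e j d) (inner i e j (d + 1)) \<and>
      legal_move G (inner i e j (d + 1)) (inner i e j d)"
  proof (cases "d < int e")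
    case True
    then have "nat (int e - d) = Suc (nat (int e - (d + 1)))" "nat (int e - (d + 1)) < len i"
      using d assms by auto
    then show ?thesis
      using True legal_outward[OF assms(1)] legal_inward[OF assms(1)] by (simp add: inner_def)
  next
    case False
    then have "nat (d + 1 - int e) = Suc (nat (d - int e))" "nat (d - int e) < len j"
      using d by auto
    moreover have "inner i e j d = pos j (nat (d - int e))" using False by (auto simp: inner_def)
    moreover have "inner i e j (d + 1) = pos j (nat (d + 1 - int e))"
      using False by (auto simp: inner_def)
    ultimately show ?thesis
      using legal_outward[OF assms(3)] legal_inward[OF assms(3)] by simp
  qed
  then show "legal_move G (inner i e j d) (inner i e j (d + 1))"
    "legal_move G (inner i e j (d + 1)) (inner i e j d)" by blast+
next
  fix u v
  assume "legal_move G u v"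
  then show "\<bar>(int e - coord i v) - (int e - coord i u)\<bar> \<le> 1"
    using coord_step[OF assms(1), of u v] by linarith
qed

lemma coord_opposite:
  assumes "v \<in> pverts G" "i < length legs" "j < length legs" "i \<noteq> j" "1 \<le> coord j v"
  shows "coord i v \<le> -1"
proof -
  obtain m d where m: "m < length legs" "d \<le> len m" "v = pos m d"
    using assms(1) by (auto simp: verts_pos)
  then show ?thesis
    using assms coord_pos[of i m d] coord_pos[of j m d] by (auto split: if_splits)
qed

lemma legal_verts: "legal_move G u v \<Longrightarrow> u \<in> pverts G \<Longrightarrow> v \<in> pverts G"
  unfolding legal_move_iff using pos_in_verts by (metis Suc_leI less_imp_le_nat)

lemma walk_verts:
  assumes "w 0 \<in> pverts G" "\<forall>t. legal_move G (w t) (w (Suc t))"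
  shows "w t \<in> pverts G"
  using assms legal_verts by (induction t) blast+

section \<open>Lower bound: forcing all but two vertices of the longest legs\<close>

text \<open>The name fits legs sorted by decreasing length. The set has one vertex more than the sum
  of the lengths, so all but two of its vertices make up the claimed number.\<close>

definition longest :: "nat \<Rightarrow> 'a set" where
  "longest n = insert c (\<Union>m<n. pos m ` {1..len m})"

lemma robbers_force_center:
  assumes \<sigma>: "cop_strategy G \<sigma>" and start: "\<sigma> [] = c"
    and n: "1 \<le> n" "n \<le> s" "n \<le> length legs"
    and dec: "\<And>i j. i \<le> j \<Longrightarrow> j < n \<Longrightarrow> len j \<le> len i"
  shows "\<exists>r. robber_play G s (cop_pos \<sigma> r) r \<and>
    (\<exists>p q. longest n - {p, q} \<subseteq> damaged s (cop_pos \<sigma> r) r)"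
proof -
  \<comment> \<open>robbers beyond the first \<open>n\<close> double the last one; leg \<open>m\<close> is swept from time \<open>\<beta> m\<close> on\<close>
  define g where "g = (\<lambda>i. min i (n - 1))"
  \<comment> \<open>Leg 0 is the longest, so \<open>N\<close> rounds suffice to sweep any leg. The
    sweeps follow one another, the last leg first, and \<open>M\<close> keeps the shadows following
    the cop until all sweeping time is over.\<close>
  define N where "N = 2 * len 0"
  define \<beta> where "\<beta> = (\<lambda>m. (n - 1 - m) * N)"
  define M where "M = n * N"
  have g: "g i < n" "g i < length legs" for i using n by (auto simp: g_def)
  have gid: "g m = m" if "m < n" for m using that by (auto simp: g_def)
  have \<beta>M: "\<beta> m + N \<le> M" if "m < n" for m
  proof -
    have "\<beta> m + N = Suc (n - 1 - m) * N" by (simp add: \<beta>_def)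
    also have "\<dots> \<le> M" unfolding M_def using that by (intro mult_le_mono1) linarith
    finally show ?thesis .
  qed
  have \<beta>dec: "\<beta> m' + N \<le> \<beta> m" if "m < m'" "m' < n" for m m'
  proof -
    have "\<beta> m' + N = Suc (n - 1 - m') * N" by (simp add: \<beta>_def)
    also have "\<dots> \<le> \<beta> m" unfolding \<beta>_def using that by (intro mult_le_mono1) linarith
    finally show ?thesis .
  qed
  have N: "nat (2 * int (len m)) \<le> N" if "m < n" for m
    using dec[of 0 m] that by (simp add: N_def nat_mult_distrib)
  have len1: "1 \<le> int (len m)" if "m < n" for m using len_pos[of m] that n by simp
  have arm: "arm G (int (len (g i))) (\<lambda>d. pos (g i) (nat d)) (coord (g i))" for i
    by (rule leg_arm[OF g(2)])
  have walk: "walk_on (int (len (g i))) (route (int (len (g i))) (\<beta> (g i)) M)" for i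
    using walk_on_route[OF len1[OF g(1)]] \<beta>M[OF g(1)] by (meson add_leD1)
  from robbers_on_arms[where s = s and k = "\<lambda>i. int (len (g i))"
      and f = "\<lambda>i d. pos (g i) (nat d)" and z = "\<lambda>i. coord (g i)", OF \<sigma> arm walk] obtain r w where
    w: "w 0 = c" "\<forall>t. legal_move G (w t) (w (Suc t))" and wr: "w = cop_pos \<sigma> r"
    and play: "robber_play G s w r"
    and dam: "\<And>i t. i < s \<Longrightarrow>
      escapes (route (int (len (g i))) (\<beta> (g i)) M (\<lambda>t. coord (g i) (w t))) (\<lambda>t. coord (g i) (w t)) t \<Longrightarrow>
      pos (g i) (nat (route (int (len (g i))) (\<beta> (g i)) M (\<lambda>t. coord (g i) (w t)) t)) \<in> damaged s w r"
    unfolding start by blast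
  define z where "z = (\<lambda>m t. coord m (w t))"
  let ?D = "damaged s w r"
  let ?x = "\<lambda>m. route (int (len m)) (\<beta> m) M (z m)"
  have dam: "pos m (nat d) \<in> ?D" if "m < n" "?x m t = d" "escapes (?x m) (z m) t" for m t d
    using dam[of m t] that n gid[OF that(1)] unfolding z_def by auto
  have wV: "w t \<in> pverts G" for t
    using walk_verts[OF _ w(2)] w(1) pos_in_verts[of 0 0] some_leg by simp
  have lip: "lipschitz_seq (z m)" if "m < n" for m
    using arm_lipschitz[OF leg_arm w(2), of m] that n unfolding z_def by simp
  have zero: "z m t = 0 \<longleftrightarrow> w t = c" if "m < n" for m t
    using coord_eq_0[OF wV] that n unfolding z_def by simp
  have z0: "z m 0 = 0" if "m < n" for m using zero[OF that] w(1) by simp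
  have far: "pos m d \<in> ?D" if m: "m < n" and d: "2 \<le> d" "d \<le> len m" for m d
  proof -
    obtain t where "?x m t = int d" "escapes (?x m) (z m) t"
      using route_covers[OF len1[OF m] lip[OF m], of "int d" "\<beta> m" M] d z0[OF m] by auto
    then show ?thesis using dam[OF m] by (metis nat_int)
  qed
  define H where "H = (\<lambda>t. \<forall>u\<le>t. w u = c)"
  have H: "H (\<beta> m) \<longleftrightarrow> (\<forall>u\<le>\<beta> m. z m u = 0)" if "m < n" for m
    using zero[OF that] by (simp add: H_def)
  have sweep: "pos m 1 \<in> ?D"
    if "m < n" "H (\<beta> m)" "\<exists>t. sweep (int (len m)) (t - \<beta> m) = 1 \<and>
      escapes (\<lambda>t. sweep (int (len m)) (t - \<beta> m)) (z m) t" for m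
    using that dam[OF that(1), of _ 1] H[OF that(1)] by (auto simp: route_eq_sweep)
  have shadow: "pos m 1 \<in> ?D"
    if "m < n" "\<not> H (\<beta> m)" "\<exists>t. shadow (int (len m)) M (z m) t = 1 \<and>
      escapes (shadow (int (len m)) M (z m)) (z m) t" for m
  proof -
    have "?x m = shadow (int (len m)) M (z m)"
      using that H by (intro route_eq_shadow) blast
    then show ?thesis using that dam[OF that(1), of _ 1] by auto
  qed
  \<comment> \<open>the last leg whose sweep starts before the cop leaves the center\<close>
  define j where "j = (LEAST j. H (\<beta> j))"
  have last: "H (\<beta> (n - 1))" using w(1) by (simp add: H_def \<beta>_def)
  have j: "H (\<beta> j)" unfolding j_def by (rule LeastI[where P = "\<lambda>j. H (\<beta> j)", OF last])
  have jn: "j < n"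
    using Least_le[of "\<lambda>j. H (\<beta> j)", OF last] n unfolding j_def by linarith
  have unstarted: "\<not> H (\<beta> m)" if "m < j" for m
    using not_less_Least[of m "\<lambda>j. H (\<beta> j)"] that unfolding j_def by blast
  \<comment> \<open>The sweeps of the legs after \<open>j\<close> are complete by
    \<open>\<beta> j\<close>, with the cop still at the center.\<close>
  have above: "pos m 1 \<in> ?D" if "j < m" "m < n" for m
  proof -
    have start: "\<beta> m + nat (2 * int (len m)) \<le> \<beta> j"
      using \<beta>dec[OF that] N[OF that(2)] by linarith
    have "z m u = 0" if "u \<le> \<beta> j" for u
      using j that zero[OF \<open>m < n\<close>] by (simp add: H_def)
    then have "\<forall>u<\<beta> m + nat (2 * int (len m)). z m u \<le> 0"
      using start by (metis less_imp_le order.refl order_trans)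
    moreover have "H (\<beta> m)"
      using j start by (simp add: H_def)
    ultimately
    show ?thesis
      using sweep[OF that(2)] sweep_first[OF len1[OF that(2)]] by blast
  qed
  have "\<exists>q<n. \<forall>m<n. m \<noteq> q \<longrightarrow> pos m 1 \<in> ?D"
  proof (cases "j = 0")
    case True
    then show ?thesis using above jn by (metis neq0_conv)
  next
    case False
    \<comment> \<open>The cop's first departure from the center. Leg \<open>j - 1\<close> did not
      get its sweep started, so this happens by \<open>\<beta> (j - 1)\<close>, well within the
      shadowing time.\<close>
    define \<tau> where "\<tau> = (LEAST t. w t \<noteq> c)"
    have "\<exists>t\<le>\<beta> (j - 1). w t \<noteq> c" using unstarted[of "j - 1"] False by (auto simp: H_def)
    then obtain t where t: "t \<le> \<beta> (j - 1)" "w t \<noteq> c" by blast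
    have \<tau>: "w \<tau> \<noteq> c" unfolding \<tau>_def by (rule LeastI[where P = "\<lambda>t. w t \<noteq> c", OF t(2)])
    have before: "w u = c" if "u < \<tau>" for u
      using not_less_Least[of u "\<lambda>t. w t \<noteq> c"] that unfolding \<tau>_def by blast
    have "\<tau> \<le> \<beta> (j - 1)"
      using Least_le[of "\<lambda>t. w t \<noteq> c", OF t(2)] t(1) unfolding \<tau>_def by simp
    then have \<tau>M: "\<tau> \<le> M" using \<beta>M[of "j - 1"] jn by linarith
    obtain i e where i: "i < length legs" "e \<le> len i" "w \<tau> = pos i e"
      using wV[of \<tau>] unfolding verts_pos by blast
    have e: "1 \<le> e" using \<tau> i by (cases e) auto
    \<comment> \<open>Stepping into leg \<open>i\<close> gives the cop a negative coordinate for
      every other leg, which draws the shadow there to depth 1.\<close>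
    have below: "pos m 1 \<in> ?D" if m: "m < j" "m \<noteq> i" for m
    proof (rule shadow)
      show "m < n" "\<not> H (\<beta> m)" using m jn unstarted by simp_all
      then have "z m \<tau> \<le> -1" using coord_pos[of m i e] i m n e unfolding z_def by simp
      moreover have "\<forall>u\<le>\<tau>. z m u < int (len m)"
      proof (intro allI impI)
        fix u
        assume "u \<le> \<tau>"
        then have "z m u \<le> 0"
          using before[of u] zero[OF \<open>m < n\<close>, of u] \<open>z m \<tau> \<le> -1\<close> by (cases "u = \<tau>") auto
        then show "z m u < int (len m)" using len1[OF \<open>m < n\<close>] by linarith
      qed
      ultimately show "\<exists>t. shadow (int (len m)) M (z m) t = 1 \<and>
          escapes (shadow (int (len m)) M (z m)) (z m) t"
        using shadow_first[OF len1[OF \<open>m < n\<close>] lip[OF \<open>m < n\<close>] \<tau>M] by blast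
    qed
    \<comment> \<open>If \<open>j \<le> i\<close>, then leg \<open>i\<close> is \<open>j\<close>
      itself, or has been swept, or is not among the first \<open>n\<close>, so only leg
      \<open>j\<close> is in doubt. Otherwise both legs are in doubt, and the duel applies with the
      sweep in the leg \<open>j\<close>, which is no longer than leg \<open>i\<close>.\<close>
    show ?thesis
    proof (cases "i < j")
      case True
      then have "i < n" using jn by simp
      have "\<forall>u\<le>\<beta> j. z i u \<le> 0"
        using j zero[OF \<open>i < n\<close>] by (metis H_def order.refl)
      moreover have "1 \<le> z j u \<Longrightarrow> z i u \<le> -1" for u
        using coord_opposite[OF wV i(1), of j u] True jn n unfolding z_def by simp
      moreover have "\<beta> j + nat (2 * int (len j)) \<le> M" using N[OF jn] \<beta>M[OF jn] by simp
      ultimately have "pos j 1 \<in> ?D \<or> pos i 1 \<in> ?D"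
        using sweep_or_shadow_first[of "int (len j)" "int (len i)" "z i" "\<beta> j" "z j" M]
          len1[OF jn] lip[OF \<open>i < n\<close>] dec[of i j] True jn
          sweep[OF jn j] shadow[OF \<open>i < n\<close> unstarted[OF True]] by force
      then show ?thesis
        using below above jn \<open>i < n\<close> by (metis linorder_neqE_nat)
    next
      case False
      then show ?thesis using below above jn by (metis linorder_neqE_nat)
    qed
  qed
  then obtain q where q: "\<And>m. m < n \<Longrightarrow> m \<noteq> q \<Longrightarrow> pos m 1 \<in> ?D" by blast
  have "longest n - {c, pos q 1} \<subseteq> ?D"
  proof
    fix v
    assume "v \<in> longest n - {c, pos q 1}"
    then obtain m d where v: "m < n" "1 \<le> d" "d \<le> len m" "v = pos m d" "v \<noteq> pos q 1"
      unfolding longest_def by auto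
    then show "v \<in> ?D" using far[of m d] q[of m] by (cases "d = 1") auto
  qed
  then show ?thesis using play unfolding wr by blast
qed

text \<open>In a leg that is not involved in the duel, the cop's coordinate is negative from the
  start. Its shadow begins at depth 1 and damages the whole leg, so at most the cop's start and one
  neighbor of it are lost.\<close>

lemma robbers_force_off_center:
  assumes \<sigma>: "cop_strategy G \<sigma>" and start: "\<sigma> [] = pos i e"
    and i: "i < length legs" and e: "1 \<le> e" "e \<le> len i"
    and n: "2 \<le> n" "n \<le> s" "n \<le> length legs"
  shows "\<exists>r. robber_play G s (cop_pos \<sigma> r) r \<and>
    (\<exists>p q. longest n - {p, q} \<subseteq> damaged s (cop_pos \<sigma> r) r)"
proof -
  define g where "g = (\<lambda>i. min i (n - 1))"
  \<comment> \<open>A leg other than \<open>i\<close> that carries a robber of its own, as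
    \<open>n\<close> is at least 2.\<close>
  define j where "j = (if i = 0 then 1 else 0 :: nat)"
  define a where "a = int (len i) - int e"
  define b where "b = int e + int (len j)"
  define M where "M = 2 * (len i + len j)"
  have g: "g i < n" "g i < length legs" for i using n by (auto simp: g_def)
  have gid: "g m = m" if "m < n" for m using that by (auto simp: g_def)
  have j: "j < n" "j < length legs" "i \<noteq> j" using n by (auto simp: j_def)
  have len1: "1 \<le> int (len m)" if "m < length legs" for m using len_pos[of m] that by simp
  have b1: "1 \<le> b" using len1[OF j(2)] by (simp add: b_def)
  \<comment> \<open>robber \<open>j\<close> comes from the center's side of the cop, as does robber \<open>i\<close> if the cop starts on a leaf\<close>
  define ins where "ins = (\<lambda>m. i < n \<and> (m = j \<or> m = i \<and> a < 1))"
  define K where "K = (\<lambda>m. if ins m then b else if m = i then a else int (len m))"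
  define F where "F = (\<lambda>m. if ins m then inner i e j
    else if m = i then (\<lambda>d. pos i (nat (int e + d))) else (\<lambda>d. pos m (nat d)))"
  define Z where "Z = (\<lambda>m. if ins m then (\<lambda>v. int e - coord i v)
    else if m = i then (\<lambda>v. coord i v - int e) else coord m)"
  \<comment> \<open>The shorter side of the cop is swept at once and the longer one shadowed, as the
    duel demands. On these arms the cop starts at coordinate 0, so \<open>route _ 0 M\<close> is a
    sweep.\<close>
  define P where "P = (\<lambda>m. if ins m then (if 1 \<le> a \<and> b < a then route b 0 M else shadow b M)
    else if m = i then (if a \<le> b then route a 0 M else shadow a M) else shadow (int (len m)) M)"
  have arm: "arm G (K (g h)) (F (g h)) (Z (g h))" for h
    using inner_arm[OF i e(2) j(2,3)] outer_arm[OF i, of e] leg_arm[OF g(2)] g(1)[of h]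
    by (auto simp: K_def F_def Z_def a_def b_def ins_def)
  have walk: "walk_on (K (g h)) (P (g h))" for h
    using b1 walk_on_route[of b 0 M] walk_on_shadow[of b M] walk_on_route[of a 0 M]
      walk_on_shadow[of a M] walk_on_shadow[OF len1[OF g(2)]] g(1)[of h]
    by (auto simp: K_def P_def ins_def)
  from robbers_on_arms[where s = s and k = "\<lambda>h. K (g h)"
      and f = "\<lambda>h. F (g h)" and z = "\<lambda>h. Z (g h)", OF \<sigma> arm walk] obtain r w where
    w: "w 0 = pos i e" "\<forall>t. legal_move G (w t) (w (Suc t))" and wr: "w = cop_pos \<sigma> r"
    and play: "robber_play G s w r"
    and dam: "\<And>h t. h < s \<Longrightarrow>
      escapes (P (g h) (\<lambda>t. Z (g h) (w t))) (\<lambda>t. Z (g h) (w t)) t \<Longrightarrow>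
      F (g h) (P (g h) (\<lambda>t. Z (g h) (w t)) t) \<in> damaged s w r"
    unfolding start by blast
  let ?D = "damaged s w r"
  have dam: "F m d \<in> ?D"
    if "m < n" "\<exists>t. P m (\<lambda>t. Z m (w t)) t = d \<and> escapes (P m (\<lambda>t. Z m (w t))) (\<lambda>t. Z m (w t)) t"
    for m d
    using dam[of m] that n gid[OF that(1)] by auto
  have other: "pos m d \<in> ?D" if m: "m < n" "m \<noteq> i" "\<not> ins m" and d: "1 \<le> d" "d \<le> len m" for m d
  proof -
    have mL: "m < length legs" using m n by simp
    have lip: "lipschitz_seq (\<lambda>t. coord m (w t))"
      by (rule arm_lipschitz[OF leg_arm[OF mL] w(2)])
    have z0: "coord m (w 0) \<le> -1" using coord_pos[OF mL i e(2)] w(1) m e by simp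
    have "\<exists>t. shadow (int (len m)) M (\<lambda>t. coord m (w t)) t = int d \<and>
        escapes (shadow (int (len m)) M (\<lambda>t. coord m (w t))) (\<lambda>t. coord m (w t)) t"
    proof (cases "d = 1")
      case True
      have "shadow (int (len m)) M (\<lambda>t. coord m (w t)) 0 = 1 \<and>
          escapes (shadow (int (len m)) M (\<lambda>t. coord m (w t))) (\<lambda>t. coord m (w t)) 0"
        by (rule shadow_first[OF len1[OF mL] lip]) (use z0 len1[OF mL] in auto)
      then show ?thesis unfolding True of_nat_1 by (rule exI)
    next
      case False
      then show ?thesis
        using shadow_covers[OF len1[OF mL] lip, of "int d" M] z0 d by auto
    qed
    then have "F m (int d) \<in> ?D" using m by (intro dam) (auto simp: P_def Z_def)
    then show ?thesis using m by (simp add: F_def)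
  qed
  have "\<exists>p q. longest n - {p, q} \<subseteq> ?D"
  proof (cases "i < n")
    case False
    \<comment> \<open>No leg that counts contains the cop's start, so all of them are damaged
      completely.\<close>
    have "longest n - {c, c} \<subseteq> ?D"
      using other False by (auto simp: longest_def ins_def)
    then show ?thesis by blast
  next
    case True
    let ?zi = "\<lambda>t. int e - coord i (w t)" and ?zo = "\<lambda>t. coord i (w t) - int e"
    let ?xi = "P j ?zi" and ?xo = "P i ?zo"
    have c0: "coord i (w 0) = int e" using coord_pos[OF i i e(2)] w(1) by simp
    have lipi: "lipschitz_seq ?zi" by (rule arm_lipschitz[OF inner_arm[OF i e(2) j(2,3)] w(2)])
    have lipo: "lipschitz_seq ?zo" using lipi by (auto simp: lipschitz_seq_def abs_minus_commute)
    have inner: "inner i e j d \<in> ?D" if "\<exists>t. ?xi t = d \<and> escapes ?xi ?zi t" for d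
      using dam[OF j(1), of d] that True by (simp add: F_def Z_def ins_def)
    have outer: "pos i (nat (int e + d)) \<in> ?D" if "1 \<le> a" "\<exists>t. ?xo t = d \<and> escapes ?xo ?zo t" for d
      using dam[OF True, of d] that j(3) by (simp add: F_def Z_def ins_def)
    have inner_far: "inner i e j d \<in> ?D" if "2 \<le> d" "d \<le> b" for d
    proof (rule inner)
      show "\<exists>t. ?xi t = d \<and> escapes ?xi ?zi t"
        using route_covers[OF b1 lipi _ that, of 0 M] shadow_covers[OF b1 lipi _ that, of M] c0 True
        by (auto simp: P_def ins_def)
    qed
    have outer_far: "pos i d \<in> ?D" if d: "e + 2 \<le> d" "d \<le> len i" for d
    proof -
      have a: "1 \<le> a" "2 \<le> int d - int e" "int d - int e \<le> a" using d by (auto simp: a_def)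
      have "\<exists>t. ?xo t = int d - int e \<and> escapes ?xo ?zo t"
        using route_covers[OF a(1) lipo _ a(2,3), of 0 M] shadow_covers[OF a(1) lipo _ a(2,3), of M]
          c0 a(1) j(3)
        by (auto simp: P_def ins_def)
      from outer[OF a(1) this] show ?thesis by simp
    qed
    have first: "inner i e j 1 \<in> ?D \<or> pos i (Suc e) \<in> ?D" if a: "1 \<le> a"
    proof -
      have M: "0 + nat (2 * a) \<le> M" "b < a \<Longrightarrow> 0 + nat (2 * b) \<le> M"
        using a e by (auto simp: M_def a_def b_def)
      have "(\<exists>t. ?xo t = 1 \<and> escapes ?xo ?zo t) \<or> (\<exists>t. ?xi t = 1 \<and> escapes ?xi ?zi t)"
      proof (cases "a \<le> b")
        case True
        then have "?xo = (\<lambda>t. sweep a (t - 0))" "?xi = shadow b M ?zi"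
          using a j(3) \<open>i < n\<close> c0 route_eq_sweep[of 0 ?zo a M] by (auto simp: P_def ins_def)
        then show ?thesis
          using sweep_or_shadow_first[OF a True lipi, of 0 ?zo M] c0 M by auto
      next
        case False
        then have "?xi = (\<lambda>t. sweep b (t - 0))" "?xo = shadow a M ?zo"
          using a j(3) \<open>i < n\<close> c0 route_eq_sweep[of 0 ?zi b M] by (auto simp: P_def ins_def)
        then show ?thesis
          using sweep_or_shadow_first[OF b1 _ lipo, of a 0 ?zi M] False c0 M by auto
      qed
      then show ?thesis using inner[of 1] outer[OF a, of 1] by (auto simp: nat_add_distrib)
    qed
    \<comment> \<open>The neighbor of the cop's start that the duel may leave undamaged. If the
      start is a leaf, \<open>pos i (Suc e)\<close> is an unspecified value, and excluding it does
      no harm.\<close>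
    define q where "q = (if inner i e j 1 \<in> ?D then pos i (Suc e) else inner i e j 1)"
    have inner_all: "inner i e j d \<in> ?D" if "1 \<le> d" "d \<le> b" "inner i e j d \<noteq> q" for d
      using inner_far[of d] that by (cases "d = 1") (auto simp: q_def split: if_splits)
    have outer_all: "pos i d \<in> ?D" if "e < d" "d \<le> len i" "pos i d \<noteq> q" for d
      using outer_far[of d] first that
      by (cases "d = Suc e") (auto simp: q_def a_def split: if_splits)
    have "longest n - {pos i e, q} \<subseteq> ?D"
    proof
      fix v
      assume v: "v \<in> longest n - {pos i e, q}"
      then consider "v = c" | m d where "v = pos m d" "m < n" "1 \<le> d" "d \<le> len m"
        by (auto simp: longest_def)
      then show "v \<in> ?D"
      proof cases
        case 1
        then show ?thesis
          using inner_all[of "int e"] v e b1 by (simp add: inner_def b_def)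
      next
        case (2 m d)
        consider "m = j" | "m = i" "e < d" | "m = i" "d = e" | "m = i" "d < e" | "m \<noteq> i" "m \<noteq> j"
          by linarith
        then show ?thesis
        proof cases
          case 1
          then show ?thesis
            using inner_all[of "int e + int d"] v 2 by (simp add: inner_def b_def)
        next
          case 4
          then have "inner i e j (int e - int d) = v" using 2 by (simp add: inner_def)
          then show ?thesis
            using inner_all[of "int e - int d"] v 4 by (simp add: b_def)
        qed (use 2 v outer_all other in \<open>auto simp: ins_def\<close>)
      qed
    qed
    then show ?thesis by blast
  qed
  then show ?thesis using play unfolding wr by blast
qed

lemma card_longest:
  assumes "n \<le> length legs"
  shows "card (longest n) = Suc (\<Sum>m<n. len m)"
proof -
  have "card (\<Union>m<n. pos m ` {1..len m}) = (\<Sum>m<n. card (pos m ` {1..len m}))"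
  proof (rule card_UN_disjoint)
    show "\<forall>i\<in>{..<n}. \<forall>j\<in>{..<n}. i \<noteq> j \<longrightarrow> pos i ` {1..len i} \<inter> pos j ` {1..len j} = {}"
      using legs_disjoint[unfolded set_leg] assms by simp
  qed simp_all
  also have "\<dots> = (\<Sum>m<n. len m)"
  proof (rule sum.cong[OF refl])
    fix m
    assume "m \<in> {..<n}"
    then have "inj_on (pos m) {1..len m}"
      using inj_on_subset[OF inj_pos[of m], of "{1..len m}"] assms by auto
    then show "card (pos m ` {1..len m}) = len m" by (simp add: card_image)
  qed
  finally have "card (\<Union>m<n. pos m ` {1..len m}) = (\<Sum>m<n. len m)" .
  moreover have "c \<notin> (\<Union>m<n. pos m ` {1..len m})"
    using c_notin_leg[unfolded set_leg] assms by simp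
  ultimately show ?thesis by (simp add: longest_def)
qed

lemma robbers_force:
  assumes \<sigma>: "cop_strategy G \<sigma>"
    and n: "2 \<le> n" "n \<le> s" "n \<le> length legs"
    and dec: "\<And>i j. i \<le> j \<Longrightarrow> j < n \<Longrightarrow> len j \<le> len i"
    and "pair_graph G"
  shows "\<exists>r. robber_play G s (cop_pos \<sigma> r) r \<and>
    (\<Sum>m<n. len m) - 1 \<le> card (damaged s (cop_pos \<sigma> r) r)"
proof -
  obtain i e where ie: "i < length legs" "e \<le> len i" "\<sigma> [] = pos i e"
    using \<sigma> unfolding cop_strategy_def verts_pos by blast
  have "\<exists>r. robber_play G s (cop_pos \<sigma> r) r \<and>
      (\<exists>p q. longest n - {p, q} \<subseteq> damaged s (cop_pos \<sigma> r) r)"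
  proof (cases "e = 0")
    case True
    then show ?thesis using robbers_force_center[OF \<sigma> _ _ n(2,3) dec] ie n by simp
  next
    case False
    then show ?thesis using robbers_force_off_center[OF \<sigma> ie(3,1) _ ie(2) n] by simp
  qed
  then obtain r p q where r: "robber_play G s (cop_pos \<sigma> r) r"
    and sub: "longest n - {p, q} \<subseteq> damaged s (cop_pos \<sigma> r) r" by blast
  have "card {p, q} \<le> 2" by (cases "p = q") auto
  then have "(\<Sum>m<n. len m) - 1 \<le> card (longest n) - card {p, q}"
    using card_longest[OF n(3)] by linarith
  also have "\<dots> \<le> card (longest n - {p, q})" by (rule diff_card_le_card_Diff) simp
  also have "\<dots> \<le> card (damaged s (cop_pos \<sigma> r) r)"
  proof (rule card_mono[OF _ sub])
    show "finite (damaged s (cop_pos \<sigma> r) r)"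
      using damaged_subset[OF \<open>pair_graph G\<close> r] verts by (metis List.finite_set finite_subset)
  qed
  finally show ?thesis using r by blast
qed

section \<open>Upper bound: the oscillating cop\<close>

text \<open>The reason why guarding the center is enough: a robber that cannot end a round there
  stays in its leg.\<close>

lemma leg_left_through_center:
  assumes "legal_move G u v" "i < length legs" "u \<in> set (legs ! i)" "v \<noteq> c"
  shows "v \<in> set (legs ! i)"
proof -
  obtain d where d: "u = pos i d" "1 \<le> d" "d \<le> len i" using assms(3) by (auto simp: set_leg)
  show ?thesis
  proof (cases "v = u")
    case True
    then show ?thesis using assms by simp
  next
    case False
    then obtain m e where m: "m < length legs" "e < len m"
      and uv: "u = pos m e \<and> v = pos m (Suc e) \<or> v = pos m e \<and> u = pos m (Suc e)"
      using assms(1) by (auto simp: legal_move_iff)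
    then have "m = i"
      using pos_eq[OF assms(2) m(1) d(3), of e] pos_eq[OF assms(2) m(1) d(3), of "Suc e"] d by auto
    moreover have "e \<noteq> 0" if "v = pos m e" using that assms(4) by (metis pos_0)
    ultimately show ?thesis using uv m by (auto simp: set_leg)
  qed
qed

end

text \<open>An exchange argument: trade the indices of \<open>I\<close> from \<open>n\<close> on for
  those missing below \<open>n\<close>. There are at least as many of the latter, and
  \<open>f (n - 1)\<close> separates the values of the two kinds.\<close>

lemma sum_le_sum_initial:
  fixes f :: "nat \<Rightarrow> nat"
  assumes "finite I" "card I \<le> n" "I \<subseteq> {..<L}" and dec: "\<And>i j. i \<le> j \<Longrightarrow> j < L \<Longrightarrow> f j \<le> f i"
    and "n \<le> L"
  shows "sum f I \<le> sum f {..<n}"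
proof (cases "n = 0")
  case True
  then show ?thesis using assms by simp
next
  case False
  define m where "m = f (n - 1)"
  have "card (I - {..<n}) \<le> card ({..<n} - I)"
  proof -
    have "card I = card (I \<inter> {..<n}) + card (I - {..<n})"
      using assms(1) by (rule card_Int_Diff)
    moreover have "n = card (I \<inter> {..<n}) + card ({..<n} - I)"
      using card_Int_Diff[of "{..<n}" I] by (simp add: Int_commute)
    ultimately show ?thesis using assms(2) by linarith
  qed
  then have "card (I - {..<n}) * m \<le> card ({..<n} - I) * m" by simp
  moreover have "sum f (I - {..<n}) \<le> card (I - {..<n}) * m"
    using sum_bounded_above[of "I - {..<n}" f m] dec[of "n - 1"] assms(3) by (force simp: m_def)
  moreover have "card ({..<n} - I) * m \<le> sum f ({..<n} - I)"
    using sum_bounded_below[of "{..<n} - I" m f] dec[of _ "n - 1"] False \<open>n \<le> L\<close>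
    by (force simp: m_def)
  moreover have "sum f I = sum f (I \<inter> {..<n}) + sum f (I - {..<n})"
    using assms(1) by (rule sum.Int_Diff)
  moreover have "sum f {..<n} = sum f (I \<inter> {..<n}) + sum f ({..<n} - I)"
    using sum.Int_Diff[of "{..<n}" f I] by (simp add: Int_commute)
  ultimately show ?thesis by linarith
qed

context spider_legs
begin

lemma oscillating_cop:
  assumes dec: "\<And>i j. i \<le> j \<Longrightarrow> j < length legs \<Longrightarrow> len j \<le> len i"
  shows "cop_guarantees G s ((\<Sum>m<min s (length legs). len m) - 1)"
proof -
  define occupied where
    "occupied = (\<lambda>R i. i < length legs \<and> (\<exists>m<s. R ! m \<in> set (legs ! i)))"
  \<comment> \<open>Leg 0 is a placeholder for the case that every robber starts at the center and
    is captured at once.\<close>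
  define post where "post = (\<lambda>R. pos (if \<exists>i. occupied R i then SOME i. occupied R i else 0) 1)"
  define \<sigma> where "\<sigma> = (\<lambda>h. if even (length h) then c else post (hd h))"
  have leg: "\<exists>i<length legs. post R = pos i 1" for R
  proof (cases "\<exists>i. occupied R i")
    case True
    then have "occupied R (SOME i. occupied R i)" by (rule someI_ex)
    then show ?thesis using True by (auto simp: post_def occupied_def)
  next
    case False
    then show ?thesis using some_leg by (auto simp: post_def)
  qed
  have edge: "legal_move G c (post R) \<and> legal_move G (post R) c" for R
  proof -
    obtain i where i: "i < length legs" "post R = pos i (Suc 0)" using leg[of R] by auto
    then show ?thesis using legal_outward[OF i(1), of 0] legal_inward[OF i(1), of 0] len_pos[OF i(1)]
      by auto
  qed
  have "cop_strategy G \<sigma>"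
    unfolding cop_strategy_def
  proof (intro conjI allI)
    show "\<sigma> [] \<in> pverts G" using pos_in_verts[of 0 0] some_leg by (simp add: \<sigma>_def)
    show "legal_move G (\<sigma> h) (\<sigma> (h @ [R]))" for h R
      using edge by (cases h) (auto simp: \<sigma>_def)
  qed
  moreover have "card (damaged s (cop_pos \<sigma> r) r) \<le> (\<Sum>m<min s (length legs). len m) - 1"
    if play: "robber_play G s (cop_pos \<sigma> r) r" for r
  proof -
    define w where "w = cop_pos \<sigma> r"
    note play = play[folded w_def]
    have w: "w t = (if even t then c else post (r 0))" for t
      by (cases t) (auto simp: w_def cop_pos_def \<sigma>_def hd_map hd_append)
    \<comment> \<open>One of \<open>w t\<close> and \<open>w (Suc t)\<close> is the center and the
      other the post, so a robber ending round \<open>t\<close> on either has met the cop or is met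
      on the cop's next move.\<close>
    have safe: "r t ! i \<noteq> c \<and> r t ! i \<noteq> post (r 0)" if "\<not> captured w r (Suc t) i" for t i
      using that w[of t] w[of "Suc t"] by (cases t) (auto split: if_splits)
    have confined: "\<exists>m<length legs. r 0 ! i \<in> set (legs ! m) \<and> r t ! i \<in> set (legs ! m)"
      if i: "i < s" and "\<not> captured w r (Suc t) i" for i t
      using that(2)
    proof (induction t)
      case 0
      obtain m d where m: "m < length legs" "d \<le> len m" "r 0 ! i = pos m d"
        using play i verts_pos unfolding robber_play_def by blast
      moreover have "d \<noteq> 0" using safe[OF 0] m by (metis pos_0)
      ultimately show ?case by (auto simp: set_leg intro!: exI[of _ m])
    next
      case (Suc t)
      have nc: "\<not> captured w r t i" "r t ! i \<noteq> w (Suc t)" "\<not> captured w r (Suc t) i"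
        using Suc.prems by auto
      then obtain m where m: "m < length legs" "r 0 ! i \<in> set (legs ! m)" "r t ! i \<in> set (legs ! m)"
        using Suc.IH by blast
      have "legal_move G (r t ! i) (r (Suc t) ! i)"
        using play i nc unfolding robber_play_def by metis
      then have "r (Suc t) ! i \<in> set (legs ! m)"
        using leg_left_through_center[OF _ m(1,3)] safe[OF Suc.prems] by blast
      then show ?case using m by blast
    qed
    define I where "I = {m. occupied (r 0) m}"
    have I: "I \<subseteq> {..<length legs}" by (auto simp: I_def occupied_def)
    then have fin: "finite I" using finite_subset by blast
    \<comment> \<open>Each occupied leg is recovered from the start of some robber, so there are at
      most \<open>s\<close> of them.\<close>
    have "I \<subseteq> (\<lambda>i. SOME m. m < length legs \<and> r 0 ! i \<in> set (legs ! m)) ` {..<s}"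
    proof
      fix m
      assume "m \<in> I"
      then obtain i where i: "m < length legs" "i < s" "r 0 ! i \<in> set (legs ! m)"
        by (auto simp: I_def occupied_def)
      then have "(SOME m. m < length legs \<and> r 0 ! i \<in> set (legs ! m)) = m"
        using legs_disjoint by (intro some_equality) auto
      then show "m \<in> (\<lambda>i. SOME m. m < length legs \<and> r 0 ! i \<in> set (legs ! m)) ` {..<s}"
        using i(2) by blast
    qed
    then have "card I \<le> s" using surj_card_le[OF finite_lessThan] by fastforce
    moreover have "card I \<le> length legs" using card_mono[OF _ I] by simp
    ultimately have sumI: "sum len I \<le> (\<Sum>m<min s (length legs). len m)"
      using fin I dec by (intro sum_le_sum_initial[of I _ "length legs"]) auto
    have sub: "damaged s w r \<subseteq> (\<Union>m\<in>I. set (legs ! m)) - {post (r 0)}"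
    proof
      fix v
      assume "v \<in> damaged s w r"
      then obtain t i where i: "i < s" "\<not> captured w r (Suc t) i" "v = r t ! i"
        unfolding damaged_def by blast
      then obtain m where "m < length legs" "r 0 ! i \<in> set (legs ! m)" "v \<in> set (legs ! m)"
        using confined by blast
      then have "m \<in> I" "v \<in> set (legs ! m)" using i(1) by (auto simp: I_def occupied_def)
      then show "v \<in> (\<Union>m\<in>I. set (legs ! m)) - {post (r 0)}"
        using safe[OF i(2)] i(3) by auto
    qed
    show ?thesis
    proof (cases "I = {}")
      case True
      then show ?thesis using sub by (simp add: w_def)
    next
      case False
      \<comment> \<open>The post lies in an occupied leg, and saving it accounts for the
        \<open>- 1\<close>.\<close>
      define i where "i = (SOME i. occupied (r 0) i)"
      have ex: "\<exists>i. occupied (r 0) i" using False by (simp add: I_def)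
      then have "i \<in> I" unfolding i_def I_def mem_Collect_eq by (rule someI_ex)
      moreover have "post (r 0) = pos i 1" using ex by (simp add: post_def i_def)
      moreover have "pos i 1 \<in> set (legs ! i)"
        using len_pos[of i] \<open>i \<in> I\<close> I by (auto simp: set_leg)
      ultimately have "post (r 0) \<in> (\<Union>m\<in>I. set (legs ! m))" by auto
      then have "card ((\<Union>m\<in>I. set (legs ! m)) - {post (r 0)}) = card (\<Union>m\<in>I. set (legs ! m)) - 1"
        by (rule card_Diff_singleton)
      moreover have "card (damaged s w r) \<le> card ((\<Union>m\<in>I. set (legs ! m)) - {post (r 0)})"
        using fin by (intro card_mono[OF _ sub]) auto
      moreover have "card (\<Union>m\<in>I. set (legs ! m)) \<le> sum len I"
        using card_UN_le[OF fin, of "\<lambda>m. set (legs ! m)"]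
          sum_mono[of I "\<lambda>m. card (set (legs ! m))" len]
        by (auto simp: len_def card_length intro: order_trans)
      ultimately show ?thesis using sumI by (simp add: w_def)
    qed
  qed
  ultimately show ?thesis unfolding cop_guarantees_def by blast
qed

lemma dmg_eq:
  assumes "2 \<le> s" "2 \<le> length legs" "pair_graph G"
    and dec: "\<And>i j. i \<le> j \<Longrightarrow> j < length legs \<Longrightarrow> len j \<le> len i"
  shows "dmg G s = (\<Sum>m<min s (length legs). len m) - 1"
  unfolding dmg_def
proof (rule Least_equality)
  show "cop_guarantees G s ((\<Sum>m<min s (length legs). len m) - 1)"
    using assms by (intro oscillating_cop) auto
next
  fix d
  assume "cop_guarantees G s d"
  then obtain \<sigma> where \<sigma>: "cop_strategy G \<sigma>"
    and d: "\<And>r. robber_play G s (cop_pos \<sigma> r) r \<Longrightarrow> card (damaged s (cop_pos \<sigma> r) r) \<le> d"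
    unfolding cop_guarantees_def by blast
  obtain r where "robber_play G s (cop_pos \<sigma> r) r"
    "(\<Sum>m<min s (length legs). len m) - 1 \<le> card (damaged s (cop_pos \<sigma> r) r)"
    using robbers_force[OF \<sigma>, of "min s (length legs)" s] assms by auto
  then show "(\<Sum>m<min s (length legs). len m) - 1 \<le> d" using d order_trans by blast
qed

end

theorem theorem3p5:
  fixes G :: "'a pair_pre_digraph" and k :: "nat list" and n l s :: nat
  assumes "spider G k"
    and "n = card (pverts G)"
    and "l = length k" and "l \<ge> 3"
    and "sorted_wrt (\<ge>) k"
  shows "(2 \<le> s \<and> s \<le> l \<longrightarrow> dmg G s = (\<Sum>i<s. k ! i) - 1) \<and>
         (s > l \<longrightarrow> dmg G s = n - 2)"
proof -
  obtain c legs where k: "map length legs = k" and legs: "distinct (c # concat legs)"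
    "pverts G = set (c # concat legs)"
    "parcs G = (\<Union>P\<in>set legs. leg_arcs c P \<union> (leg_arcs c P)\<inverse>)"
    and pos: "\<forall>x\<in>set k. 1 \<le> x"
    using assms(1) unfolding spider_def by blast
  have l: "l = length legs" using k assms(3) by auto
  interpret spider_legs G c legs
    using legs pos k l assms(4) by unfold_locales auto
  have len: "len i = k ! i" if "i < l" for i
    using that l k by (auto simp: len_def)
  have dec: "len j \<le> len i" if "i \<le> j" "j < length legs" for i j
    using that len l assms(3) sorted_wrt_nth_less[OF assms(5), of i j] by (cases "i = j") auto
  have "dmg G s = (\<Sum>m<min s l. len m) - 1" if "2 \<le> s"
    using dmg_eq[OF that _ spider_pair_graph[OF assms(1)] dec] l assms(4) by simp
  also have "(\<Sum>m<min s l. len m) = (\<Sum>m<min s l. k ! m)"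
    by (intro sum.cong) (auto simp: len)
  finally have dmg: "dmg G s = (\<Sum>m<min s l. k ! m) - 1" if "2 \<le> s"
    using that by blast
  have "(\<Sum>m<l. k ! m) = sum_list k"
    using assms(3) by (simp add: sum_list_sum_nth atLeast0LessThan)
  \<comment> \<open>\<open>n\<close> counts the center as well, which is the second vertex that is
    saved.\<close>
  then have "(\<Sum>m<l. k ! m) - 1 = n - 2" using card_spider[OF assms(1)] assms(2) by simp
  then show ?thesis using dmg assms(4) by (auto simp: min_def)
qed

end
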